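(* Let $\mathbf{A}=(A;\wedge,\vee,\to,*,\neg,0,\bot,\top)$ be an OLg-algebra, and put $\Diamond x:=x\wedge\top$ and $\Diamond(\mathbf{A}):=(\Diamond[A];\wedge,\vee,\to,0,\top)$. Then $\mathbf{A}$ is isomorphic to an OLg-twist-algebra over $\Diamond(\mathbf{A})$, as witnessed by the map $\iota\colon\mathbf{A}\to\Diamond(\mathbf{A})\times\Diamond(\mathbf{A})$, $a\mapsto(\Diamond a,\Diamond\neg a)$.
   Context: A De Morgan algebra is a bounded distributive lattice $(A;\wedge,\vee,0,1)$ with a unary operation $\neg$ satisfying $\neg\neg a=a$ and $\neg(a\wedge b)=\neg a\vee\neg b$ (so $1=\neg 0$). A DFg-algebra is an algebra $(A;\wedge,\vee,\neg,0,1,\bot,\top)$ such that $(A;\wedge,\vee,\neg,0,1)$ is a De Morgan algebra, $\neg\bot=\bot$, $\neg\top=\top$, and $\bot\wedge\top=0$. A CNg-algebra is a DFg-algebra expanded with a binary operation $\to$ satisfying, with $\Diamond x:=x\wedge\top$: (1) $(x\wedge y)\to z=x\to(y\to z)$; (2) $\top\le x\to(y\to y)$; (3) $\top\le((x\to y)\to x)\to x$; (4) $\Diamond(x\to y)=\Diamond x\to\Diamond y$; (5) $\neg(x\to y)=x\to\neg y$; (6) $\Diamond(x\wedge y)=\Diamond(x\wedge(x\to y))$. An OLg-algebra is a CNg-algebra expanded with a binary operation $*$ satisfying: ($*$1) $\Diamond(x*y)=\Diamond(x\wedge y)$; ($*$2) $\Diamond\neg(x*y)=(x\to\Diamond\neg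 y)\wedge(y\to\Diamond\neg x)$; ($*$3) $\Diamond x\to\Diamond y=x\to\Diamond y$. $\Diamond(\mathbf{A})$ carries the operations of $\mathbf{A}$ restricted to $\Diamond[A]=\{a\wedge\top:a\in A\}$; it is a Boolean algebra with implication $\to$, least element $0$ and greatest element $\top$. For a Boolean algebra $\mathbf{B}$ (with Boolean implication $\to$), the full OLg-twist-algebra $\mathbf{B}^{\bowtie}$ has universe $B\times B$ and operations $(x_1,x_2)\wedge(y_1,y_2):=(x_1\wedge y_1,x_2\vee y_2)$, $\neg(x_1,x_2):=(x_2,x_1)$, $(x_1,x_2)\to(y_1,y_2):=(x_1\to y_1,x_1\to y_2)$, $\top:=(1,1)$, $\bot:=(0,0)$, and $(x_1,x_2)*(y_1,y_2):=(x_1\wedge y_1,(x_1\to y_2)\wedge(y_1\to x_2))$; moreover $x\vee y:=\neg(\neg x\wedge\neg y)$ and the lattice bottom is $(0,1)$. An OLg-twist-algebra over $\mathbf{B}$ is any subalgebra $\mathbf{C}\leqslant\mathbf{B}^{\bowtie}$ such that $\pi_1[C]=B$, where $\pi_1$ is the first projection. *)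

theory Defs
  imports "HOL-Algebra.Congruence"
begin

text \<open>
  Algebras are records with an explicit carrier, and all identities are relativised to it.
  An explicit carrier is needed because the Boolean algebra \<open>\<diamond>(A)\<close> lives on a subset of
  the universe of \<open>A\<close>, and subalgebras on subsets of a product.
\<close>


section \<open>Bounded distributive lattices and Boolean algebras\<close>

record 'a lattice_sig = "'a partial_object" +
  lmeet :: "'a \<Rightarrow> 'a \<Rightarrow> 'a"  (infixl \<open>\<sqinter>\<index>\<close> 70)
  ljoin :: "'a \<Rightarrow> 'a \<Rightarrow> 'a"  (infixl \<open>\<squnion>\<index>\<close> 65)
  lzero :: 'a  (\<open>\<zero>\<index>\<close>)
  lone :: 'a  (\<open>\<one>\<index>\<close>)

definition lle :: "('a, 'm) lattice_sig_scheme \<Rightarrow> 'a \<Rightarrow> 'a \<Rightarrow> bool"  (infix \<open>\<sqsubseteq>\<index>\<close> 50)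
  where "x \<sqsubseteq>\<^bsub>L\<^esub> y \<longleftrightarrow> x \<sqinter>\<^bsub>L\<^esub> y = x"

locale bounded_distrib_lattice =
  fixes L (structure)
  assumes meet_closed: "x \<in> carrier L \<Longrightarrow> y \<in> carrier L \<Longrightarrow> x \<sqinter> y \<in> carrier L"
    and join_closed: "x \<in> carrier L \<Longrightarrow> y \<in> carrier L \<Longrightarrow> x \<squnion> y \<in> carrier L"
    and zero_closed: "\<zero> \<in> carrier L"
    and one_closed: "\<one> \<in> carrier L"
    and meet_comm: "x \<in> carrier L \<Longrightarrow> y \<in> carrier L \<Longrightarrow> x \<sqinter> y = y \<sqinter> x"
    and join_comm: "x \<in> carrier L \<Longrightarrow> y \<in> carrier L \<Longrightarrow> x \<squnion> y = y \<squnion> x"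
    and meet_assoc: "x \<in> carrier L \<Longrightarrow> y \<in> carrier L \<Longrightarrow> z \<in> carrier L \<Longrightarrow>
        (x \<sqinter> y) \<sqinter> z = x \<sqinter> (y \<sqinter> z)"
    and join_assoc: "x \<in> carrier L \<Longrightarrow> y \<in> carrier L \<Longrightarrow> z \<in> carrier L \<Longrightarrow>
        (x \<squnion> y) \<squnion> z = x \<squnion> (y \<squnion> z)"
    and meet_absorb: "x \<in> carrier L \<Longrightarrow> y \<in> carrier L \<Longrightarrow> x \<sqinter> (x \<squnion> y) = x"
    and join_absorb: "x \<in> carrier L \<Longrightarrow> y \<in> carrier L \<Longrightarrow> x \<squnion> (x \<sqinter> y) = x"
    and meet_join_distrib: "x \<in> carrier L \<Longrightarrow> y \<in> carrier L \<Longrightarrow> z \<in> carrier L \<Longrightarrow>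
        x \<sqinter> (y \<squnion> z) = (x \<sqinter> y) \<squnion> (x \<sqinter> z)"
    and zero_least: "x \<in> carrier L \<Longrightarrow> \<zero> \<sqsubseteq> x"
    and one_greatest: "x \<in> carrier L \<Longrightarrow> x \<sqsubseteq> \<one>"

text \<open>
  Boolean algebras come in the signature \<open>(\<and>, \<or>, \<rightarrow>, 0, 1)\<close>: complementation is the derived
  operation \<open>x \<mapsto> (x \<rightarrow> 0)\<close>, and \<open>x \<rightarrow> y\<close> is the join of the complement of \<open>x\<close> with \<open>y\<close>.
\<close>

record 'a boolean_sig = "'a lattice_sig" +
  bimp :: "'a \<Rightarrow> 'a \<Rightarrow> 'a"  (infixr \<open>\<hookrightarrow>\<index>\<close> 60)

locale boolean_algebra_on = bounded_distrib_lattice B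
  for B :: "('a, 'm) boolean_sig_scheme" (structure) +
  assumes bimp_closed: "x \<in> carrier B \<Longrightarrow> y \<in> carrier B \<Longrightarrow> (x \<hookrightarrow> y) \<in> carrier B"
    and meet_compl: "x \<in> carrier B \<Longrightarrow> x \<sqinter> (x \<hookrightarrow> \<zero>) = \<zero>"
    and join_compl: "x \<in> carrier B \<Longrightarrow> x \<squnion> (x \<hookrightarrow> \<zero>) = \<one>"
    and bimp_eq: "x \<in> carrier B \<Longrightarrow> y \<in> carrier B \<Longrightarrow> (x \<hookrightarrow> y) = (x \<hookrightarrow> \<zero>) \<squnion> y"


section \<open>De Morgan, DFg-, CNg- and OLg-algebras\<close>

text \<open>
  The lattice bounds are \<open>\<zero>\<close> and \<open>\<one>\<close>; the constants \<open>\<bottom>\<close> and \<open>\<top>\<close> are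
  fixed points of the negation and are not the bounds of the lattice order.
\<close>

record 'a de_morgan_sig = "'a lattice_sig" +
  lneg :: "'a \<Rightarrow> 'a"  (\<open>\<sim>\<index> _\<close> [81] 80)

locale de_morgan_algebra = bounded_distrib_lattice A
  for A :: "('a, 'm) de_morgan_sig_scheme" (structure) +
  assumes neg_closed: "x \<in> carrier A \<Longrightarrow> \<sim> x \<in> carrier A"
    and neg_neg: "x \<in> carrier A \<Longrightarrow> \<sim> (\<sim> x) = x"
    and neg_meet: "x \<in> carrier A \<Longrightarrow> y \<in> carrier A \<Longrightarrow> \<sim> (x \<sqinter> y) = \<sim> x \<squnion> \<sim> y"

record 'a dfg_sig = "'a de_morgan_sig" +
  dbot :: 'a  (\<open>\<bottom>\<index>\<close>)
  dtop :: 'a  (\<open>\<top>\<index>\<close>)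

locale dfg_algebra = de_morgan_algebra A
  for A :: "('a, 'm) dfg_sig_scheme" (structure) +
  assumes bot_closed: "\<bottom> \<in> carrier A"
    and top_closed: "\<top> \<in> carrier A"
    and neg_bot: "\<sim> \<bottom> = \<bottom>"
    and neg_top: "\<sim> \<top> = \<top>"
    and bot_meet_top: "\<bottom> \<sqinter> \<top> = \<zero>"

definition dia :: "('a, 'm) dfg_sig_scheme \<Rightarrow> 'a \<Rightarrow> 'a"  (\<open>\<diamond>\<index> _\<close> [81] 80)
  where "\<diamond>\<^bsub>A\<^esub> x = x \<sqinter>\<^bsub>A\<^esub> \<top>\<^bsub>A\<^esub>"

record 'a cng_sig = "'a dfg_sig" +
  cimp :: "'a \<Rightarrow> 'a \<Rightarrow> 'a"  (infixr \<open>\<rightharpoonup>\<index>\<close> 60)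

locale cng_algebra = dfg_algebra A
  for A :: "('a, 'm) cng_sig_scheme" (structure) +
  assumes imp_closed: "x \<in> carrier A \<Longrightarrow> y \<in> carrier A \<Longrightarrow> (x \<rightharpoonup> y) \<in> carrier A"
    and imp_curry: "x \<in> carrier A \<Longrightarrow> y \<in> carrier A \<Longrightarrow> z \<in> carrier A \<Longrightarrow>
        ((x \<sqinter> y) \<rightharpoonup> z) = (x \<rightharpoonup> (y \<rightharpoonup> z))"
    and imp_refl: "x \<in> carrier A \<Longrightarrow> y \<in> carrier A \<Longrightarrow> \<top> \<sqsubseteq> (x \<rightharpoonup> (y \<rightharpoonup> y))"
    and imp_peirce: "x \<in> carrier A \<Longrightarrow> y \<in> carrier A \<Longrightarrow> \<top> \<sqsubseteq> (((x \<rightharpoonup> y) \<rightharpoonup> x) \<rightharpoonup> x)"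
    and dia_imp: "x \<in> carrier A \<Longrightarrow> y \<in> carrier A \<Longrightarrow> \<diamond> (x \<rightharpoonup> y) = (\<diamond> x \<rightharpoonup> \<diamond> y)"
    and neg_imp: "x \<in> carrier A \<Longrightarrow> y \<in> carrier A \<Longrightarrow> \<sim> (x \<rightharpoonup> y) = (x \<rightharpoonup> \<sim> y)"
    and dia_meet_imp: "x \<in> carrier A \<Longrightarrow> y \<in> carrier A \<Longrightarrow>
        \<diamond> (x \<sqinter> y) = \<diamond> (x \<sqinter> (x \<rightharpoonup> y))"

record 'a olg_sig = "'a cng_sig" +
  ostar :: "'a \<Rightarrow> 'a \<Rightarrow> 'a"  (infixl \<open>\<star>\<index>\<close> 70)

locale olg_algebra = cng_algebra A
  for A :: "('a, 'm) olg_sig_scheme" (structure) +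
  assumes star_closed: "x \<in> carrier A \<Longrightarrow> y \<in> carrier A \<Longrightarrow> x \<star> y \<in> carrier A"
    and dia_star: "x \<in> carrier A \<Longrightarrow> y \<in> carrier A \<Longrightarrow> \<diamond> (x \<star> y) = \<diamond> (x \<sqinter> y)"
    and dia_neg_star: "x \<in> carrier A \<Longrightarrow> y \<in> carrier A \<Longrightarrow>
        \<diamond> (\<sim> (x \<star> y)) = (x \<rightharpoonup> \<diamond> (\<sim> y)) \<sqinter> (y \<rightharpoonup> \<diamond> (\<sim> x))"
    and dia_imp_dia: "x \<in> carrier A \<Longrightarrow> y \<in> carrier A \<Longrightarrow> (\<diamond> x \<rightharpoonup> \<diamond> y) = (x \<rightharpoonup> \<diamond> y)"


section \<open>Homomorphisms and subalgebras of OLg-type\<close>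

definition olg_hom ::
    "('a, 'm) olg_sig_scheme \<Rightarrow> ('b, 'n) olg_sig_scheme \<Rightarrow> ('a \<Rightarrow> 'b) set"
  where "olg_hom A C =
    {f. f ` carrier A \<subseteq> carrier C \<and>
        (\<forall>x \<in> carrier A. \<forall>y \<in> carrier A.
           f (x \<sqinter>\<^bsub>A\<^esub> y) = f x \<sqinter>\<^bsub>C\<^esub> f y \<and>
           f (x \<squnion>\<^bsub>A\<^esub> y) = f x \<squnion>\<^bsub>C\<^esub> f y \<and>
           f (x \<rightharpoonup>\<^bsub>A\<^esub> y) = (f x \<rightharpoonup>\<^bsub>C\<^esub> f y) \<and>
           f (x \<star>\<^bsub>A\<^esub> y) = f x \<star>\<^bsub>C\<^esub> f y) \<and>
        (\<forall>x \<in> carrier A. f (\<sim>\<^bsub>A\<^esub> x) = \<sim>\<^bsub>C\<^esub> (f x)) \<and>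
        f \<zero>\<^bsub>A\<^esub> = \<zero>\<^bsub>C\<^esub> \<and> f \<one>\<^bsub>A\<^esub> = \<one>\<^bsub>C\<^esub> \<and>
        f \<bottom>\<^bsub>A\<^esub> = \<bottom>\<^bsub>C\<^esub> \<and> f \<top>\<^bsub>A\<^esub> = \<top>\<^bsub>C\<^esub>}"

definition olg_iso ::
    "('a, 'm) olg_sig_scheme \<Rightarrow> ('b, 'n) olg_sig_scheme \<Rightarrow> ('a \<Rightarrow> 'b) set"
  where "olg_iso A C = {f \<in> olg_hom A C. bij_betw f (carrier A) (carrier C)}"

definition olg_subuniverse :: "'a set \<Rightarrow> ('a, 'm) olg_sig_scheme \<Rightarrow> bool"
  where "olg_subuniverse S A \<longleftrightarrow>
    S \<subseteq> carrier A \<and>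
    (\<forall>x \<in> S. \<forall>y \<in> S.
       x \<sqinter>\<^bsub>A\<^esub> y \<in> S \<and> x \<squnion>\<^bsub>A\<^esub> y \<in> S \<and> (x \<rightharpoonup>\<^bsub>A\<^esub> y) \<in> S \<and> x \<star>\<^bsub>A\<^esub> y \<in> S) \<and>
    (\<forall>x \<in> S. \<sim>\<^bsub>A\<^esub> x \<in> S) \<and>
    \<zero>\<^bsub>A\<^esub> \<in> S \<and> \<one>\<^bsub>A\<^esub> \<in> S \<and> \<bottom>\<^bsub>A\<^esub> \<in> S \<and> \<top>\<^bsub>A\<^esub> \<in> S"

definition olg_subalgebra :: "'a olg_sig \<Rightarrow> 'a olg_sig \<Rightarrow> bool"
  where "olg_subalgebra C A \<longleftrightarrow>
    olg_subuniverse (carrier C) A \<and> C = A\<lparr>carrier := carrier C\<rparr>"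


section \<open>Twist-algebras and the Boolean algebra of \<open>\<diamond>\<close>-elements\<close>

definition twist_neg :: "'a \<times> 'a \<Rightarrow> 'a \<times> 'a"
  where "twist_neg = (\<lambda>(x1, x2). (x2, x1))"

definition twist_meet ::
    "('a, 'm) boolean_sig_scheme \<Rightarrow> 'a \<times> 'a \<Rightarrow> 'a \<times> 'a \<Rightarrow> 'a \<times> 'a"
  where "twist_meet B = (\<lambda>(x1, x2) (y1, y2). (x1 \<sqinter>\<^bsub>B\<^esub> y1, x2 \<squnion>\<^bsub>B\<^esub> y2))"

definition full_twist :: "('a, 'm) boolean_sig_scheme \<Rightarrow> ('a \<times> 'a) olg_sig"
  where "full_twist B =
    \<lparr> carrier = carrier B \<times> carrier B,
      lmeet = twist_meet B,
      ljoin = (\<lambda>x y. twist_neg (twist_meet B (twist_neg x) (twist_neg y))),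
      lzero = (\<zero>\<^bsub>B\<^esub>, \<one>\<^bsub>B\<^esub>),
      lone = twist_neg (\<zero>\<^bsub>B\<^esub>, \<one>\<^bsub>B\<^esub>),
      lneg = twist_neg,
      dbot = (\<zero>\<^bsub>B\<^esub>, \<zero>\<^bsub>B\<^esub>),
      dtop = (\<one>\<^bsub>B\<^esub>, \<one>\<^bsub>B\<^esub>),
      cimp = (\<lambda>(x1, x2) (y1, y2). (x1 \<hookrightarrow>\<^bsub>B\<^esub> y1, x1 \<hookrightarrow>\<^bsub>B\<^esub> y2)),
      ostar = (\<lambda>(x1, x2) (y1, y2).
        (x1 \<sqinter>\<^bsub>B\<^esub> y1, (x1 \<hookrightarrow>\<^bsub>B\<^esub> y2) \<sqinter>\<^bsub>B\<^esub> (y1 \<hookrightarrow>\<^bsub>B\<^esub> x2))) \<rparr>"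

definition olg_twist_algebra ::
    "('a \<times> 'a) olg_sig \<Rightarrow> ('a, 'm) boolean_sig_scheme \<Rightarrow> bool"
  where "olg_twist_algebra C B \<longleftrightarrow>
    boolean_algebra_on B \<and> olg_subalgebra C (full_twist B) \<and> fst ` carrier C = carrier B"

text \<open>The greatest element of \<open>\<diamond>(A)\<close> is \<open>\<top>\<close>, not the lattice bound \<open>\<one>\<close> of \<open>A\<close>.\<close>

definition dia_algebra :: "('a, 'm) cng_sig_scheme \<Rightarrow> 'a boolean_sig"
  where "dia_algebra A =
    \<lparr> carrier = (\<lambda>a. \<diamond>\<^bsub>A\<^esub> a) ` carrier A,
      lmeet = lmeet A,
      ljoin = ljoin A,
      lzero = \<zero>\<^bsub>A\<^esub>,
      lone = \<top>\<^bsub>A\<^esub>,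
      bimp = cimp A \<rparr>"

definition twist_embedding :: "('a, 'm) dfg_sig_scheme \<Rightarrow> 'a \<Rightarrow> 'a \<times> 'a"
  where "twist_embedding A a = (\<diamond>\<^bsub>A\<^esub> a, \<diamond>\<^bsub>A\<^esub> (\<sim>\<^bsub>A\<^esub> a))"

end

theory Submission
  imports Defs
begin

text \<open>
  An element \<open>a\<close> of a bounded distributive lattice is determined by \<open>a \<and> \<top>\<close> and
  \<open>a \<or> \<top>\<close>. As \<open>\<top>\<close> is a fixed point of the negation, \<open>a \<or> \<top>\<close> is the negation of
  \<open>\<not>a \<and> \<top>\<close>, so the two coordinates \<open>\<diamond>a\<close> and \<open>\<diamond>\<not>a\<close> determine \<open>a\<close>. This is the
  injectivity of \<open>\<iota>\<close>.

  That \<open>\<iota>\<close> preserves the operations is what the axioms say: the twist operations are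
  read off from the equations that push \<open>\<diamond>\<close> and \<open>\<diamond>\<not>\<close> through each operation of the
  algebra. In the second coordinate, the join comes from the De Morgan law, \<open>x\<^sub>1 \<rightarrow> y\<^sub>2\<close> comes
  from \<open>\<not>(x \<rightarrow> y) = x \<rightarrow> \<not>y\<close>, and the formula for \<open>*\<close> comes from its axiom for \<open>\<diamond>\<not>(x * y)\<close>,
  where the last axiom on \<open>*\<close> replaces \<open>x\<close> by \<open>\<diamond>x\<close> to the left of an arrow. The image
  of a homomorphism is closed under the operations, hence carries a subalgebra.

  What needs an argument is that \<open>\<diamond>(A)\<close> is a Boolean algebra. It is the lattice interval
  from \<open>0\<close> to \<open>\<top>\<close>, and there \<open>\<rightarrow>\<close> is the residual of the meet
  (\<open>cng_algebra.dia_residuation\<close>). So \<open>\<diamond>(A)\<close> is a Heyting algebra, and Peirce's law makes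
  a Heyting algebra Boolean (\<open>boolean_algebra_on_if_peirce\<close>).
\<close>


section \<open>Order and cancellation in bounded distributive lattices\<close>

context bounded_distrib_lattice
begin

lemma lle_refl: "x \<in> carrier L \<Longrightarrow> x \<sqsubseteq> x"
  unfolding lle_def using meet_absorb[of x "x \<sqinter> x"] join_absorb[of x x] meet_closed[of x x]
  by simp

lemma meet_idem: "x \<in> carrier L \<Longrightarrow> x \<sqinter> x = x"
  using lle_refl unfolding lle_def .

lemma lle_antisym:
  "x \<in> carrier L \<Longrightarrow> y \<in> carrier L \<Longrightarrow> x \<sqsubseteq> y \<Longrightarrow> y \<sqsubseteq> x \<Longrightarrow> x = y"
  unfolding lle_def using meet_comm[of x y] by simp

lemma lle_trans:
  assumes "x \<in> carrier L" "y \<in> carrier L" "z \<in> carrier L" and "x \<sqsubseteq> y" "y \<sqsubseteq> z"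
  shows "x \<sqsubseteq> z"
  using assms meet_assoc[of x y z] unfolding lle_def by simp

lemma meet_lle2: "x \<in> carrier L \<Longrightarrow> y \<in> carrier L \<Longrightarrow> x \<sqinter> y \<sqsubseteq> y"
  unfolding lle_def using meet_assoc[of x y y] meet_idem[of y] by simp

lemma meet_lle1: "x \<in> carrier L \<Longrightarrow> y \<in> carrier L \<Longrightarrow> x \<sqinter> y \<sqsubseteq> x"
  using meet_lle2[of y x] meet_comm[of x y] by simp

lemma lle_join1: "x \<in> carrier L \<Longrightarrow> y \<in> carrier L \<Longrightarrow> x \<sqsubseteq> x \<squnion> y"
  unfolding lle_def by (rule meet_absorb)

lemma lle_join2: "x \<in> carrier L \<Longrightarrow> y \<in> carrier L \<Longrightarrow> y \<sqsubseteq> x \<squnion> y"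
  using lle_join1[of y x] join_comm[of x y] by simp

lemma join_meet_distrib:
  "x \<in> carrier L \<Longrightarrow> y \<in> carrier L \<Longrightarrow> z \<in> carrier L \<Longrightarrow>
    (x \<squnion> y) \<sqinter> z = (x \<sqinter> z) \<squnion> (y \<sqinter> z)"
  using meet_join_distrib[of z x y] meet_comm[of z] join_closed[of x y] by simp

lemma join_lleI:
  "x \<in> carrier L \<Longrightarrow> y \<in> carrier L \<Longrightarrow> z \<in> carrier L \<Longrightarrow> x \<sqsubseteq> z \<Longrightarrow> y \<sqsubseteq> z \<Longrightarrow>
    x \<squnion> y \<sqsubseteq> z"
  unfolding lle_def by (simp add: join_meet_distrib)

lemma meet_meet_distrib:
  assumes "x \<in> carrier L" "y \<in> carrier L" "z \<in> carrier L"
  shows "(x \<sqinter> y) \<sqinter> z = (x \<sqinter> z) \<sqinter> (y \<sqinter> z)"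
proof -
  have "(x \<sqinter> z) \<sqinter> (y \<sqinter> z) = x \<sqinter> (z \<sqinter> (y \<sqinter> z))"
    using assms by (simp add: meet_assoc meet_closed)
  also have "z \<sqinter> (y \<sqinter> z) = y \<sqinter> z"
    using assms meet_lle2[of y z] meet_comm[of z "y \<sqinter> z"] by (simp add: lle_def meet_closed)
  finally show ?thesis
    using assms by (simp add: meet_assoc)
qed

text \<open>
  By absorption and distributivity, \<open>a = a \<and> (a \<or> t) = a \<and> (b \<or> t) = (a \<and> b) \<or> (a \<and> t)\<close>,
  and under the hypotheses the last expression is symmetric in \<open>a\<close> and \<open>b\<close>.
\<close>

lemma meet_join_cancel:
  assumes car: "a \<in> carrier L" "b \<in> carrier L" "t \<in> carrier L"
    and meet: "a \<sqinter> t = b \<sqinter> t" and join: "a \<squnion> t = b \<squnion> t"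
  shows "a = b"
proof -
  have "a = a \<sqinter> (b \<squnion> t)"
    using car meet_absorb[of a t] join by simp
  also have "\<dots> = (b \<sqinter> a) \<squnion> (b \<sqinter> t)"
    using car meet by (simp add: meet_join_distrib meet_comm[of b a])
  also have "\<dots> = b \<sqinter> (a \<squnion> t)"
    using car by (simp add: meet_join_distrib)
  also have "\<dots> = b"
    using car meet_absorb[of b t] join by simp
  finally show ?thesis .
qed

end


section \<open>Boolean algebras from residuation and Peirce's law\<close>

text \<open>
  For \<open>u = x \<or> (x \<rightarrow> 0)\<close> one has \<open>u \<rightarrow> 0 \<le> x \<rightarrow> 0 \<le> u\<close>, so \<open>(u \<rightarrow> 0) \<rightarrow> u = 1\<close>. Peirce's law
  for \<open>u\<close> and \<open>0\<close> then collapses to \<open>1 \<rightarrow> u = 1\<close>, which forces \<open>u = 1\<close>. Excluded middle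
  in turn gives \<open>x \<rightarrow> y \<le> (x \<rightarrow> 0) \<or> y\<close> by splitting the left-hand side over \<open>u\<close>.
\<close>

lemma boolean_algebra_on_if_peirce:
  fixes B :: "('a, 'm) boolean_sig_scheme" (structure)
  assumes "bounded_distrib_lattice B"
    and imp_closed: "\<And>x y. x \<in> carrier B \<Longrightarrow> y \<in> carrier B \<Longrightarrow> (x \<hookrightarrow> y) \<in> carrier B"
    and residuation: "\<And>x y z. x \<in> carrier B \<Longrightarrow> y \<in> carrier B \<Longrightarrow> z \<in> carrier B \<Longrightarrow>
        z \<sqsubseteq> (x \<hookrightarrow> y) \<longleftrightarrow> x \<sqinter> z \<sqsubseteq> y"
    and peirce: "\<And>x y. x \<in> carrier B \<Longrightarrow> y \<in> carrier B \<Longrightarrow>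
        (((x \<hookrightarrow> y) \<hookrightarrow> x) \<hookrightarrow> x) = \<one>"
  shows "boolean_algebra_on B"
proof -
  interpret bounded_distrib_lattice B by fact
  note closed = meet_closed join_closed zero_closed one_closed imp_closed
  have modus_ponens: "x \<sqinter> (x \<hookrightarrow> y) \<sqsubseteq> y" if "x \<in> carrier B" "y \<in> carrier B" for x y
    using that residuation[of x y "x \<hookrightarrow> y"] by (simp add: closed lle_refl)
  have meet_compl: "x \<sqinter> (x \<hookrightarrow> \<zero>) = \<zero>" if "x \<in> carrier B" for x
    using that modus_ponens[of x \<zero>] by (intro lle_antisym) (simp_all add: closed zero_least)
  have join_compl: "x \<squnion> (x \<hookrightarrow> \<zero>) = \<one>" if x: "x \<in> carrier B" for x
  proof -
    define n where "n = (x \<hookrightarrow> \<zero>)"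
    define u where "u = x \<squnion> n"
    have car: "n \<in> carrier B" "u \<in> carrier B" "(u \<hookrightarrow> \<zero>) \<in> carrier B"
      using x by (simp_all add: n_def u_def closed)
    have "x \<sqinter> (u \<hookrightarrow> \<zero>) \<sqsubseteq> u \<sqinter> (u \<hookrightarrow> \<zero>)"
    proof -
      have "x \<sqinter> u = x"
        using x car by (simp add: u_def meet_absorb)
      then have "(x \<sqinter> (u \<hookrightarrow> \<zero>)) \<sqinter> (u \<sqinter> (u \<hookrightarrow> \<zero>)) = x \<sqinter> (u \<hookrightarrow> \<zero>)"
        using x car by (simp add: meet_meet_distrib[symmetric])
      then show ?thesis by (simp add: lle_def)
    qed
    then have "(u \<hookrightarrow> \<zero>) \<sqsubseteq> n"
      using x car by (simp add: n_def residuation meet_compl closed)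
    moreover have "n \<sqsubseteq> u"
      using x car by (simp add: u_def lle_join2)
    ultimately have le: "(u \<hookrightarrow> \<zero>) \<sqsubseteq> u"
      using car by (blast intro: lle_trans)
    then have "(u \<hookrightarrow> \<zero>) \<sqinter> \<one> \<sqsubseteq> u"
      using car one_greatest[of "u \<hookrightarrow> \<zero>"] by (simp add: lle_def)
    then have "\<one> \<sqsubseteq> ((u \<hookrightarrow> \<zero>) \<hookrightarrow> u)"
      using car by (simp add: residuation closed)
    then have "((u \<hookrightarrow> \<zero>) \<hookrightarrow> u) = \<one>"
      using car by (intro lle_antisym) (simp_all add: closed one_greatest)
    with peirce[of u \<zero>] have "(\<one> \<hookrightarrow> u) = \<one>"
      using car by (simp add: closed)
    with modus_ponens[of \<one> u] have "\<one> \<sqsubseteq> u"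
      using car by (simp add: closed meet_idem)
    then show ?thesis
      using car unfolding n_def[symmetric] u_def[symmetric]
      by (intro lle_antisym) (simp_all add: closed one_greatest)
  qed
  have imp_eq: "(x \<hookrightarrow> y) = (x \<hookrightarrow> \<zero>) \<squnion> y" if x: "x \<in> carrier B" and y: "y \<in> carrier B" for x y
  proof -
    define n where "n = (x \<hookrightarrow> \<zero>)"
    define i where "i = (x \<hookrightarrow> y)"
    have car: "n \<in> carrier B" "i \<in> carrier B"
      using x y by (simp_all add: n_def i_def closed)
    have "i \<sqsubseteq> n \<squnion> y"
    proof -
      have "i = (x \<squnion> n) \<sqinter> i"
        using x car one_greatest[of i] meet_comm[of i \<one>]
        by (simp add: n_def join_compl lle_def closed)
      also have "\<dots> = (x \<sqinter> i) \<squnion> (n \<sqinter> i)"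
        using x car by (simp add: join_meet_distrib)
      finally have split: "i = (x \<sqinter> i) \<squnion> (n \<sqinter> i)" .
      have "x \<sqinter> i \<sqsubseteq> n \<squnion> y"
        using x y car modus_ponens[of x y] lle_join2[of n y]
          lle_trans[of "x \<sqinter> i" y "n \<squnion> y"] by (simp add: i_def closed)
      moreover have "n \<sqinter> i \<sqsubseteq> n \<squnion> y"
        using y car meet_lle1[of n i] lle_join1[of n y]
          lle_trans[of "n \<sqinter> i" n "n \<squnion> y"] by (simp add: closed)
      ultimately have "(x \<sqinter> i) \<squnion> (n \<sqinter> i) \<sqsubseteq> n \<squnion> y"
        using x y car by (intro join_lleI) (simp_all add: closed)
      with split show ?thesis by simp
    qed
    moreover have "n \<squnion> y \<sqsubseteq> i"
    proof (rule join_lleI)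
      have "x \<sqinter> n \<sqsubseteq> y"
        using x y by (simp add: n_def meet_compl zero_least)
      then show "n \<sqsubseteq> i"
        using x y car by (simp add: i_def residuation)
      show "y \<sqsubseteq> i"
        using x y by (simp add: i_def residuation meet_lle2)
    qed (use y car in simp_all)
    ultimately show ?thesis
      using y car unfolding n_def[symmetric] i_def[symmetric]
      by (intro lle_antisym) (simp_all add: closed)
  qed
  show ?thesis
    by (unfold_locales) (simp_all only: imp_closed meet_compl join_compl, rule imp_eq)
qed


section \<open>The interval below \<open>\<top>\<close>\<close>

context de_morgan_algebra
begin

lemma neg_join:
  assumes "x \<in> carrier A" "y \<in> carrier A"
  shows "\<sim> (x \<squnion> y) = \<sim> x \<sqinter> \<sim> y"
proof -
  have "\<sim> (\<sim> x \<sqinter> \<sim> y) = x \<squnion> y"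
    using assms by (simp add: neg_meet neg_closed neg_neg)
  then show ?thesis
    using assms neg_neg[of "\<sim> x \<sqinter> \<sim> y"] by (simp add: meet_closed neg_closed)
qed

lemma neg_zero: "\<sim> \<zero> = \<one>"
proof (rule lle_antisym)
  have "\<sim> \<one> = \<sim> \<one> \<squnion> \<zero>"
    using join_absorb[of "\<sim> \<one>" \<zero>] zero_least[of "\<sim> \<one>"] meet_comm[of \<zero> "\<sim> \<one>"]
    by (simp add: lle_def zero_closed one_closed neg_closed)
  then have "\<sim> (\<sim> \<one>) = \<sim> (\<sim> \<one>) \<sqinter> \<sim> \<zero>"
    using neg_join[of "\<sim> \<one>" \<zero>] by (simp add: zero_closed one_closed neg_closed)
  then show "\<one> \<sqsubseteq> \<sim> \<zero>"
    by (simp add: lle_def neg_neg one_closed)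
qed (simp_all add: zero_closed one_closed neg_closed one_greatest)

lemma neg_one: "\<sim> \<one> = \<zero>"
  using neg_neg[OF zero_closed] by (simp add: neg_zero)

end

context dfg_algebra
begin

lemma dia_closed: "x \<in> carrier A \<Longrightarrow> \<diamond> x \<in> carrier A"
  by (simp add: dia_def meet_closed top_closed)

lemma dia_meet: "x \<in> carrier A \<Longrightarrow> y \<in> carrier A \<Longrightarrow> \<diamond> (x \<sqinter> y) = \<diamond> x \<sqinter> \<diamond> y"
  by (simp add: dia_def meet_meet_distrib top_closed)

lemma dia_join: "x \<in> carrier A \<Longrightarrow> y \<in> carrier A \<Longrightarrow> \<diamond> (x \<squnion> y) = \<diamond> x \<squnion> \<diamond> y"
  by (simp add: dia_def join_meet_distrib top_closed)

lemma dia_dia: "x \<in> carrier A \<Longrightarrow> \<diamond> (\<diamond> x) = \<diamond> x"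
  by (simp add: dia_def meet_assoc meet_idem top_closed)

lemma dia_zero: "\<diamond> \<zero> = \<zero>"
  using zero_least[OF top_closed] by (simp add: dia_def lle_def)

lemma dia_one: "\<diamond> \<one> = \<top>"
  using one_greatest[OF top_closed] meet_comm[OF one_closed top_closed]
  by (simp add: dia_def lle_def)

lemma dia_bot: "\<diamond> \<bottom> = \<zero>"
  by (simp add: dia_def bot_meet_top)

lemma dia_top: "\<diamond> \<top> = \<top>"
  by (simp add: dia_def meet_idem top_closed)

lemma dia_image_iff: "x \<in> dia A ` carrier A \<longleftrightarrow> x \<in> carrier A \<and> \<diamond> x = x"
  by (force simp: dia_closed dia_dia)

text \<open>
  The second coordinate of the embedding records \<open>a \<or> \<top>\<close>, which is the negation of \<open>\<not>a \<and> \<top>\<close>.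
\<close>

lemma inj_on_twist_embedding: "inj_on (twist_embedding A) (carrier A)"
proof (rule inj_onI)
  have neg_dia_neg: "\<sim> (\<diamond> (\<sim> x)) = x \<squnion> \<top>" if "x \<in> carrier A" for x
    using that by (simp add: dia_def neg_meet neg_closed neg_neg neg_top top_closed)
  fix a b
  assume car: "a \<in> carrier A" "b \<in> carrier A" and "twist_embedding A a = twist_embedding A b"
  then have "a \<sqinter> \<top> = b \<sqinter> \<top>" and "\<diamond> (\<sim> a) = \<diamond> (\<sim> b)"
    by (simp_all add: twist_embedding_def dia_def)
  moreover from this have "a \<squnion> \<top> = b \<squnion> \<top>"
    using neg_dia_neg[of a] neg_dia_neg[of b] car by simp
  ultimately show "a = b"
    using car meet_join_cancel[of a b \<top>] by (simp add: top_closed)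
qed

end

context cng_algebra
begin

lemma dia_fixed_imp:
  assumes "x \<in> carrier A" "\<diamond> x = x" "y \<in> carrier A" "\<diamond> y = y"
  shows "\<diamond> (x \<rightharpoonup> y) = (x \<rightharpoonup> y)"
  using assms by (simp add: dia_imp)

lemma dia_meet_imp_fixed:
  assumes "x \<in> carrier A" "\<diamond> x = x" "y \<in> carrier A" "\<diamond> y = y"
  shows "x \<sqinter> (x \<rightharpoonup> y) = x \<sqinter> y"
  using assms dia_meet_imp[of x y] by (simp add: dia_meet imp_closed dia_fixed_imp)

lemma dia_fixed_eq_top:
  assumes "x \<in> carrier A" "\<diamond> x = x" "\<top> \<sqsubseteq> x"
  shows "x = \<top>"
  using assms meet_comm[of x \<top>] by (simp add: dia_def lle_def top_closed)

text \<open>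
  Both directions rest on \<open>x \<and> (x \<rightarrow> y) = x \<and> y\<close>. From left to right this is modus ponens. In
  the other direction, \<open>x \<and> z = x \<and> z \<and> y\<close>, so currying rewrites \<open>z \<rightarrow> (x \<rightarrow> y)\<close> to
  \<open>(x \<and> z) \<rightarrow> (y \<rightarrow> y)\<close>, which is \<open>\<top>\<close>, and modus ponens with \<open>z\<close> gives \<open>z \<le> x \<rightarrow> y\<close>.
\<close>

lemma dia_residuation:
  assumes x: "x \<in> carrier A" "\<diamond> x = x" and y: "y \<in> carrier A" "\<diamond> y = y"
    and z: "z \<in> carrier A" "\<diamond> z = z"
  shows "z \<sqsubseteq> (x \<rightharpoonup> y) \<longleftrightarrow> x \<sqinter> z \<sqsubseteq> y"
proof
  assume "z \<sqsubseteq> (x \<rightharpoonup> y)"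
  then have "x \<sqinter> z = x \<sqinter> ((x \<rightharpoonup> y) \<sqinter> z)"
    using x y z meet_comm[of z "x \<rightharpoonup> y"] by (simp add: lle_def imp_closed)
  also have "\<dots> = (x \<sqinter> y) \<sqinter> z"
    using x y z meet_assoc[of x "x \<rightharpoonup> y" z] by (simp add: dia_meet_imp_fixed imp_closed)
  also have "\<dots> = (x \<sqinter> z) \<sqinter> y"
    using x y z by (simp add: meet_assoc meet_comm[of y z])
  finally show "x \<sqinter> z \<sqsubseteq> y"
    by (simp add: lle_def)
next
  assume "x \<sqinter> z \<sqsubseteq> y"
  then have xz: "(x \<sqinter> z) \<sqinter> y = x \<sqinter> z"
    by (simp add: lle_def)
  have "(z \<rightharpoonup> (x \<rightharpoonup> y)) = ((x \<sqinter> z) \<rightharpoonup> y)"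
    using x y z by (simp add: imp_curry[symmetric] meet_comm[of z x])
  also have "\<dots> = ((x \<sqinter> z) \<rightharpoonup> (y \<rightharpoonup> y))"
    using x y z xz imp_curry[of "x \<sqinter> z" y y] by (simp add: meet_closed)
  also have "\<dots> = \<top>"
    using x y z by (intro dia_fixed_eq_top)
      (simp_all add: imp_closed meet_closed dia_fixed_imp dia_meet imp_refl)
  finally have "z \<sqinter> (x \<rightharpoonup> y) = z \<sqinter> \<top>"
    using x y z dia_meet_imp_fixed[of z "x \<rightharpoonup> y"] by (simp add: imp_closed dia_fixed_imp)
  then show "z \<sqsubseteq> (x \<rightharpoonup> y)"
    using z by (simp add: lle_def dia_def)
qed

lemma dia_algebra_simps:
  "carrier (dia_algebra A) = dia A ` carrier A"
  "x \<sqinter>\<^bsub>dia_algebra A\<^esub> y = x \<sqinter> y"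
  "x \<squnion>\<^bsub>dia_algebra A\<^esub> y = x \<squnion> y"
  "\<zero>\<^bsub>dia_algebra A\<^esub> = \<zero>"
  "\<one>\<^bsub>dia_algebra A\<^esub> = \<top>"
  "(x \<hookrightarrow>\<^bsub>dia_algebra A\<^esub> y) = (x \<rightharpoonup> y)"
  "x \<sqsubseteq>\<^bsub>dia_algebra A\<^esub> y \<longleftrightarrow> x \<sqsubseteq> y"
  by (simp_all add: dia_algebra_def lle_def)

theorem boolean_algebra_on_dia_algebra: "boolean_algebra_on (dia_algebra A)"
proof (rule boolean_algebra_on_if_peirce)
  show "bounded_distrib_lattice (dia_algebra A)"
    by (unfold_locales, unfold dia_algebra_simps dia_image_iff)
      (auto simp: meet_closed join_closed zero_closed top_closed dia_meet dia_join dia_zero dia_top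
        meet_assoc join_assoc meet_absorb join_absorb meet_join_distrib zero_least
        intro: meet_comm join_comm, simp add: lle_def dia_def)
  show "\<And>x y. x \<in> carrier (dia_algebra A) \<Longrightarrow> y \<in> carrier (dia_algebra A) \<Longrightarrow>
      (x \<hookrightarrow>\<^bsub>dia_algebra A\<^esub> y) \<in> carrier (dia_algebra A)"
    by (simp add: dia_algebra_simps dia_image_iff imp_closed dia_fixed_imp)
  show "\<And>x y z. x \<in> carrier (dia_algebra A) \<Longrightarrow> y \<in> carrier (dia_algebra A) \<Longrightarrow>
      z \<in> carrier (dia_algebra A) \<Longrightarrow>
      z \<sqsubseteq>\<^bsub>dia_algebra A\<^esub> (x \<hookrightarrow>\<^bsub>dia_algebra A\<^esub> y) \<longleftrightarrow>
      x \<sqinter>\<^bsub>dia_algebra A\<^esub> z \<sqsubseteq>\<^bsub>dia_algebra A\<^esub> y"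
    by (simp add: dia_algebra_simps dia_image_iff dia_residuation)
  show "\<And>x y. x \<in> carrier (dia_algebra A) \<Longrightarrow> y \<in> carrier (dia_algebra A) \<Longrightarrow>
      (((x \<hookrightarrow>\<^bsub>dia_algebra A\<^esub> y) \<hookrightarrow>\<^bsub>dia_algebra A\<^esub> x) \<hookrightarrow>\<^bsub>dia_algebra A\<^esub> x) =
      \<one>\<^bsub>dia_algebra A\<^esub>"
    unfolding dia_algebra_simps dia_image_iff
    by (intro dia_fixed_eq_top) (simp_all add: imp_closed dia_fixed_imp imp_peirce)
qed

end


section \<open>The twist embedding\<close>

lemma olg_subalgebra_image_if_olg_hom:
  assumes hom: "f \<in> olg_hom A D"
    and closed: "\<And>x y. x \<in> carrier A \<Longrightarrow> y \<in> carrier A \<Longrightarrow>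
      x \<sqinter>\<^bsub>A\<^esub> y \<in> carrier A \<and> x \<squnion>\<^bsub>A\<^esub> y \<in> carrier A \<and>
      (x \<rightharpoonup>\<^bsub>A\<^esub> y) \<in> carrier A \<and> x \<star>\<^bsub>A\<^esub> y \<in> carrier A"
    "\<And>x. x \<in> carrier A \<Longrightarrow> \<sim>\<^bsub>A\<^esub> x \<in> carrier A"
    "\<zero>\<^bsub>A\<^esub> \<in> carrier A" "\<one>\<^bsub>A\<^esub> \<in> carrier A" "\<bottom>\<^bsub>A\<^esub> \<in> carrier A" "\<top>\<^bsub>A\<^esub> \<in> carrier A"
  shows "olg_subalgebra (D\<lparr>carrier := f ` carrier A\<rparr>) D"
proof -
  have sub: "f ` carrier A \<subseteq> carrier D"
    using hom by (simp add: olg_hom_def)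
  have binary:
    "f x \<sqinter>\<^bsub>D\<^esub> f y = f (x \<sqinter>\<^bsub>A\<^esub> y)" "f x \<squnion>\<^bsub>D\<^esub> f y = f (x \<squnion>\<^bsub>A\<^esub> y)"
    "(f x \<rightharpoonup>\<^bsub>D\<^esub> f y) = f (x \<rightharpoonup>\<^bsub>A\<^esub> y)" "f x \<star>\<^bsub>D\<^esub> f y = f (x \<star>\<^bsub>A\<^esub> y)"
    if "x \<in> carrier A" "y \<in> carrier A" for x y
    using hom that by (simp_all add: olg_hom_def)
  have unary: "\<sim>\<^bsub>D\<^esub> (f x) = f (\<sim>\<^bsub>A\<^esub> x)" if "x \<in> carrier A" for x
    using hom that by (simp add: olg_hom_def)
  have constants: "\<zero>\<^bsub>D\<^esub> = f \<zero>\<^bsub>A\<^esub>" "\<one>\<^bsub>D\<^esub> = f \<one>\<^bsub>A\<^esub>" "\<bottom>\<^bsub>D\<^esub> = f \<bottom>\<^bsub>A\<^esub>" "\<top>\<^bsub>D\<^esub> = f \<top>\<^bsub>A\<^esub>"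
    using hom by (simp_all add: olg_hom_def)
  have "olg_subuniverse (f ` carrier A) D"
    unfolding olg_subuniverse_def constants
    using sub by (auto simp: binary unary closed)
  then show ?thesis
    by (simp add: olg_subalgebra_def)
qed

context olg_algebra
begin

lemma twist_embedding_hom: "twist_embedding A \<in> olg_hom A (full_twist (dia_algebra A))"
proof -
  have "twist_embedding A ` carrier A \<subseteq> carrier (full_twist (dia_algebra A))"
    by (auto simp: twist_embedding_def full_twist_def dia_algebra_simps neg_closed)
  moreover have "\<diamond> (\<sim> (x \<rightharpoonup> y)) = (\<diamond> x \<rightharpoonup> \<diamond> (\<sim> y))"
    if "x \<in> carrier A" "y \<in> carrier A" for x y
    using that by (simp add: neg_imp dia_imp neg_closed)
  moreover have "\<diamond> (\<sim> (x \<star> y)) = (\<diamond> x \<rightharpoonup> \<diamond> (\<sim> y)) \<sqinter> (\<diamond> y \<rightharpoonup> \<diamond> (\<sim> x))"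
    if "x \<in> carrier A" "y \<in> carrier A" for x y
    using that by (simp add: dia_neg_star dia_imp_dia neg_closed)
  ultimately show ?thesis
    by (simp add: olg_hom_def twist_embedding_def full_twist_def twist_meet_def twist_neg_def
        dia_algebra_simps neg_closed neg_neg neg_meet neg_join neg_zero neg_one neg_bot neg_top
        dia_meet dia_join dia_imp dia_star dia_zero dia_one dia_bot dia_top)
qed

end

theorem theorem56:
  fixes A :: "('a, 'm) olg_sig_scheme"
  assumes "olg_algebra A"
  shows "\<exists>C. olg_twist_algebra C (dia_algebra A) \<and> twist_embedding A \<in> olg_iso A C"
proof -
  interpret olg_algebra A by fact
  let ?T = "full_twist (dia_algebra A)"
  define C where "C = ?T\<lparr>carrier := twist_embedding A ` carrier A\<rparr>"
  have "olg_subalgebra C ?T"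
    unfolding C_def using twist_embedding_hom
    by (rule olg_subalgebra_image_if_olg_hom)
      (simp_all add: meet_closed join_closed imp_closed star_closed neg_closed
        zero_closed one_closed bot_closed top_closed)
  moreover have "fst ` carrier C = carrier (dia_algebra A)"
    by (simp add: C_def image_image twist_embedding_def dia_algebra_simps)
  ultimately have "olg_twist_algebra C (dia_algebra A)"
    by (simp add: olg_twist_algebra_def boolean_algebra_on_dia_algebra)
  moreover have "twist_embedding A \<in> olg_iso A C"
    using twist_embedding_hom inj_on_twist_embedding
    by (simp add: olg_iso_def olg_hom_def C_def bij_betw_def)
  ultimately show ?thesis by blast
qed

end
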